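(* Let $(\mathcal{X},\mathcal{F})$ be a measurable space, let $\mathcal{M}$ be a set of probability measures on it, and let $\Phi:\mathcal{W}\to\mathcal{M}$, $w\mapsto P_w$, be a (possibly non-injective) parameterization with $\mathcal{W}\subset\mathbb{R}^d$. Let $f:\mathcal{W}\to\mathbb{R}^k$ be non-identifiable. Suppose there exist disjoint sets $A,B\subset\mathbb{R}^k$ and parameters $w_0,w_1\in\mathcal{W}$ such that $$f(w_0)\in A,\qquad f(w_1)\in B,\qquad P_{w_0}=P_{w_1}.$$ Define $\mathcal{W}_0=\{w\in\mathcal{W}:f(w)\in A\}$, $\mathcal{W}_1=\{w\in\mathcal{W}:f(w)\in B\}$, and $\mathcal{M}_i=\Phi(\mathcal{W}_i)$ for $i=0,1$. Then $\mathcal{M}_0\cap\mathcal{M}_1\neq\varnothing$. Consequently, no uniformly consistent test exists for distinguishing $H_0:P\in\mathcal{M}_0$ from $H_1:P\in\mathcal{M}_1$; that is, there is no sequence of tests $\phi_n:\mathcal{X}^n\to\{0,1\}$ with both $\alpha_n(\phi_n)\to0$ and $\beta_n(\phi_n)\to0$ as $n\to\infty$.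
   Context: A function $f:\mathcal{W}\to\mathbb{R}^k$ is non-identifiable if there exist $w,w'\in\mathcal{W}$ such that $P_w=P_{w'}$ but $f(w)\neq f(w')$. For a probability measure $P$ on $(\mathcal{X},\mathcal{F})$, $P^n$ denotes the $n$-fold product measure on $\mathcal{X}^n$. A test (nonrandomized) based on $n$ observations is a measurable function $\phi_n:\mathcal{X}^n\to\{0,1\}$. For $\mathcal{M}_0,\mathcal{M}_1\subset\mathcal{M}$, the worst-case Type I and Type II errors are $$\alpha_n(\phi_n)=\sup_{P\in\mathcal{M}_0}P^n(\phi_n=1),\qquad \beta_n(\phi_n)=\sup_{Q\in\mathcal{M}_1}Q^n(\phi_n=0).$$ *)

theory Defs
  imports "HOL-Probability.Probability"
begin

text \<open>A measurable space is given by some \<open>X :: 'x measure\<close>, of which only \<open>space X\<close> and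
  \<open>sets X\<close> matter. The probability measures on it are the elements of \<open>space (prob_algebra X)\<close>.\<close>

definition nonidentifiable ::
  "'w set \<Rightarrow> ('w \<Rightarrow> 'x measure) \<Rightarrow> ('w \<Rightarrow> 'b) \<Rightarrow> bool" where
  "nonidentifiable W P f \<longleftrightarrow> (\<exists>w\<in>W. \<exists>w'\<in>W. P w = P w' \<and> f w \<noteq> f w')"

text \<open>The \<open>n\<close>-fold product; points of the sample space are extensional functions on \<open>{..<n}\<close>.\<close>

definition nfold_product :: "nat \<Rightarrow> 'x measure \<Rightarrow> (nat \<Rightarrow> 'x) measure" where
  "nfold_product n P = PiM {..<n} (\<lambda>_. P)"

definition is_test :: "'x measure \<Rightarrow> nat \<Rightarrow> ((nat \<Rightarrow> 'x) \<Rightarrow> nat) \<Rightarrow> bool" where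
  "is_test X n \<phi> \<longleftrightarrow> \<phi> \<in> nfold_product n X \<rightarrow>\<^sub>M count_space {0, 1}"

text \<open>The suprema are taken in \<open>ennreal\<close>, so that they are meaningful for every (also empty) class.\<close>

definition typeI_error ::
  "'x measure set \<Rightarrow> nat \<Rightarrow> ((nat \<Rightarrow> 'x) \<Rightarrow> nat) \<Rightarrow> ennreal" where
  "typeI_error M0 n \<phi> =
     (SUP P\<in>M0. emeasure (nfold_product n P) {x \<in> space (nfold_product n P). \<phi> x = 1})"

definition typeII_error ::
  "'x measure set \<Rightarrow> nat \<Rightarrow> ((nat \<Rightarrow> 'x) \<Rightarrow> nat) \<Rightarrow> ennreal" where
  "typeII_error M1 n \<phi> =
     (SUP Q\<in>M1. emeasure (nfold_product n Q) {x \<in> space (nfold_product n Q). \<phi> x = 0})"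

definition uniformly_consistent_test ::
  "'x measure \<Rightarrow> 'x measure set \<Rightarrow> 'x measure set \<Rightarrow> (nat \<Rightarrow> (nat \<Rightarrow> 'x) \<Rightarrow> nat) \<Rightarrow> bool" where
  "uniformly_consistent_test X M0 M1 \<phi> \<longleftrightarrow>
     (\<forall>n\<ge>1. is_test X n (\<phi> n)) \<and>
     (\<lambda>n. typeI_error M0 n (\<phi> n)) \<longlonglongrightarrow> 0 \<and>
     (\<lambda>n. typeII_error M1 n (\<phi> n)) \<longlonglongrightarrow> 0"

end

theory Submission
  imports Defs
begin

text \<open>
  The two parameters \<open>w0\<close> and \<open>w1\<close> induce the same law \<open>P\<close>, so \<open>P\<close> belongs to both hypotheses.
  For any single test, accepting and rejecting are complementary events, so under \<open>P\<^sup>n\<close> their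
  probabilities add up to one. Since \<open>P\<close> is admissible in both suprema, the sum of the two worst-case
  errors is at least one for every sample size (lemma \<open>one_le_sum_of_errors\<close>). Two sequences that
  both tend to zero cannot have this property.
\<close>

lemma prob_space_nfold_product:
  assumes "prob_space P"
  shows "prob_space (nfold_product n P)"
  unfolding nfold_product_def using assms by (intro prob_space_PiM)

text \<open>Only the \<open>\<sigma>\<close>-algebra of a sample law enters measurability, so a test on the reference space
  \<open>X\<close> is a test under every law on \<open>X\<close>.\<close>

lemma is_test_cong_sets:
  assumes "sets P = sets X"
  shows "is_test P n \<phi> \<longleftrightarrow> is_test X n \<phi>"
proof -
  have "sets (nfold_product n P) = sets (nfold_product n X)"
    unfolding nfold_product_def using assms by (intro sets_PiM_cong) auto
  then show ?thesis
    unfolding is_test_def using measurable_cong_sets[OF _ refl] by blast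
qed

text \<open>A law shared by both hypotheses cannot be told apart from itself: the power of the
  test against \<open>P\<close> as an alternative equals its rejection probability under \<open>P\<close> as a null law.\<close>

lemma one_le_sum_of_errors:
  assumes P: "P \<in> space (prob_algebra X)" and "P \<in> M0" "P \<in> M1" and test: "is_test X n \<phi>"
  shows "1 \<le> typeI_error M0 n \<phi> + typeII_error M1 n \<phi>"
proof -
  let ?N = "nfold_product n P"
  let ?R = "\<lambda>i. {x \<in> space ?N. \<phi> x = i}"
  have "sets P = sets X" "prob_space P"
    using P by (auto simp: space_prob_algebra)
  then interpret prob_space ?N
    by (intro prob_space_nfold_product)
  have \<phi>: "\<phi> \<in> ?N \<rightarrow>\<^sub>M count_space {0, 1}"
    using test is_test_cong_sets[OF \<open>sets P = sets X\<close>] by (auto simp: is_test_def)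
  have meas: "?R i \<in> sets ?N" if "i \<in> {0, 1}" for i
    using measurable_sets[OF \<phi>, of "{i}"] that
    by (simp add: vimage_def Int_def conj_commute)
  have "space ?N = ?R 1 \<union> ?R 0"
    using measurable_space[OF \<phi>] by fastforce
  then have "1 = emeasure ?N (?R 1 \<union> ?R 0)"
    using emeasure_space_1 by simp
  also have "\<dots> \<le> emeasure ?N (?R 1) + emeasure ?N (?R 0)"
    using meas by (intro emeasure_subadditive) auto
  also have "\<dots> \<le> typeI_error M0 n \<phi> + typeII_error M1 n \<phi>"
    unfolding typeI_error_def typeII_error_def
    using assms(2,3) by (intro add_mono SUP_upper)
  finally show ?thesis .
qed

lemma not_uniformly_consistent_if_common_law:
  assumes "P \<in> space (prob_algebra X)" "P \<in> M0" "P \<in> M1"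
  shows "\<not> uniformly_consistent_test X M0 M1 \<phi>"
proof
  assume cons: "uniformly_consistent_test X M0 M1 \<phi>"
  let ?s = "\<lambda>n. typeI_error M0 n (\<phi> n) + typeII_error M1 n (\<phi> n)"
  have "?s \<longlonglongrightarrow> 0 + 0"
    using cons unfolding uniformly_consistent_test_def by (intro tendsto_add) auto
  moreover have "1 \<le> ?s n" if "n \<ge> 1" for n
    using cons that assms unfolding uniformly_consistent_test_def
    by (intro one_le_sum_of_errors) auto
  ultimately have "(1::ennreal) \<le> 0 + 0"
    by (intro LIMSEQ_le_const) auto
  then show False by simp
qed

theorem proposition1:
  fixes X :: "'x measure"
    and \<M> M0 M1 :: "'x measure set"
    and W W0 W1 :: "(real ^ 'd) set"
    and \<Phi> :: "real ^ 'd \<Rightarrow> 'x measure"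
    and f :: "real ^ 'd \<Rightarrow> real ^ 'k"
    and A B :: "(real ^ 'k) set"
    and w0 w1 :: "real ^ 'd"
  assumes "\<M> \<subseteq> space (prob_algebra X)"
    and "\<Phi> \<in> W \<rightarrow> \<M>"
    and "nonidentifiable W \<Phi> f"
    and "A \<inter> B = {}"
    and "w0 \<in> W" and "w1 \<in> W"
    and "f w0 \<in> A" and "f w1 \<in> B" and "\<Phi> w0 = \<Phi> w1"
    and "W0 = {w \<in> W. f w \<in> A}" and "W1 = {w \<in> W. f w \<in> B}"
    and "M0 = \<Phi> ` W0" and "M1 = \<Phi> ` W1"
  shows "M0 \<inter> M1 \<noteq> {} \<and> \<not> (\<exists>\<phi>. uniformly_consistent_test X M0 M1 \<phi>)"
proof -
  have "\<Phi> w0 \<in> space (prob_algebra X)"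
    using assms(1,2,5) by auto
  moreover have "\<Phi> w0 \<in> M0"
    using assms by blast
  moreover have "\<Phi> w0 \<in> M1"
    unfolding \<open>\<Phi> w0 = \<Phi> w1\<close> using assms by blast
  ultimately show ?thesis
    using not_uniformly_consistent_if_common_law by blast
qed

end
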